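(* Let $(S,+)$ be a semigroup, let $(\mathbb{F},+,\cdot)$ be a field, and let $B\colon S\times S\to\mathbb{F}$ be a symmetric and biadditive function. If a function $f\colon S\to\mathbb{F}$ satisfies \[ f(x+y)-f(x)-f(y)=B(x,y)\qquad\text{for all } x,y\in S, \] then there exists an additive function $a\colon S\to\mathbb{F}$ (i.e. $a(x+y)=a(x)+a(y)$ for all $x,y\in S$) such that \[ f(x)=\tfrac12 B(x,x)+a(x)\qquad\text{for all } x\in S. \]
   Context: Biadditive means that $B$ is additive in each variable separately: $B(x+x',y)=B(x,y)+B(x',y)$ and $B(x,y+y')=B(x,y)+B(x,y')$ for all $x,x',y,y'\in S$. Symmetric means $B(x,y)=B(y,x)$ for all $x,y\in S$.
   Formalization: The field is assumed to have characteristic different from 2 (2 ≠ 0), since otherwise the factor 1/2 in the claimed formula is undefined. *)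

theory Defs
  imports Main
begin

(* The library locale "additive" needs abelian groups on both sides; here the domain
   is only a semigroup, not assumed commutative. *)
definition additive_map :: "('s::semigroup_add \<Rightarrow> 'f::semigroup_add) \<Rightarrow> bool" where
  "additive_map a \<longleftrightarrow> (\<forall>x y. a (x + y) = a x + a y)"

definition biadditive :: "('s::semigroup_add \<Rightarrow> 's \<Rightarrow> 'f::semigroup_add) \<Rightarrow> bool" where
  "biadditive B \<longleftrightarrow>
     (\<forall>x x' y. B (x + x') y = B x y + B x' y) \<and>
     (\<forall>x y y'. B x (y + y') = B x y + B x y')"

definition symmetric_map :: "('s \<Rightarrow> 's \<Rightarrow> 'f) \<Rightarrow> bool" where
  "symmetric_map B \<longleftrightarrow> (\<forall>x y. B x y = B y x)"

end

theory Submission imports Defs begin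

text \<open>The map sending x to \<open>1 / 2 * B x x\<close> has the same Cauchy difference as
  \<open>f\<close>, namely \<open>B\<close>: this is polarization, with
  \<open>biadditive_diagonal_add\<close> supplying the expansion of the diagonal. Cauchy differences
  are linear in the function, so subtracting this map from \<open>f\<close> leaves Cauchy difference
  zero, which is additivity.\<close>

text \<open>Biadditivity yields the cross terms \<open>B x y\<close> and \<open>B y x\<close>;
  symmetry merges them into the factor 2.\<close>

lemma biadditive_diagonal_add:
  fixes B :: "'s::semigroup_add \<Rightarrow> 's \<Rightarrow> 'f::comm_ring_1"
  assumes "symmetric_map B" and "biadditive B"
  shows "B (x + y) (x + y) = B x x + 2 * B x y + B y y"
proof -
  have "B (x + y) (x + y) = B x x + B x y + (B y x + B y y)"
    using assms(2) by (simp add: biadditive_def)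
  moreover have "B y x = B x y"
    using assms(1) by (simp add: symmetric_map_def)
  ultimately show ?thesis
    by (simp only: mult_2 add.assoc)
qed

theorem proposition1:
  fixes B :: "'s::semigroup_add \<Rightarrow> 's \<Rightarrow> 'f::field"
    and f :: "'s \<Rightarrow> 'f"
  assumes two_nonzero: "(2::'f) \<noteq> 0"
    and "symmetric_map B"
    and "biadditive B"
    and "\<And>x y. f (x + y) - f x - f y = B x y"
  shows "\<exists>a. additive_map a \<and> (\<forall>x. f x = 1 / 2 * B x x + a x)"
proof -
  \<comment> \<open>The desired formula for \<open>f\<close> forces this choice.\<close>
  define a where "a x = f x - 1 / 2 * B x x" for x
  have "a (x + y) = a x + a y" for x y
  proof -
    have f_add: "f (x + y) = f x + f y + B x y"
      using assms(4)[of x y] by (simp add: algebra_simps)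
    \<comment> \<open>Halving cancels the 2 of the cross term. This needs characteristic other than
      2: if 2 = 0, then \<open>1 / 2\<close> is 0 in HOL and the cross term is lost.\<close>
    have half: "1 / 2 * B (x + y) (x + y) = 1 / 2 * B x x + B x y + 1 / 2 * B y y"
      using two_nonzero
      by (simp add: biadditive_diagonal_add[OF assms(2,3)] distrib_left)
    show ?thesis
      unfolding a_def f_add half by (simp only: algebra_simps)
  qed
  then have "additive_map a"
    by (simp add: additive_map_def)
  moreover have "\<forall>x. f x = 1 / 2 * B x x + a x"
    by (simp add: a_def)
  ultimately show ?thesis by blast
qed

end
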